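(* Let $(C,d)$ be a nonempty complete metric space, let $\alpha\in[0,1)$, let $\psi\in\Psi_\alpha$, and let $T_1,T_2:C\to C$ be two mappings satisfying $$d(T_1(x),T_2(y))\leq \psi\bigl(d(x,y),\,d(x,T_1(x)),\,d(y,T_2(y))\bigr)\quad\text{for all } x,y\in C.$$ Then the following assertions hold: (i) $T_1$ and $T_2$ have a unique common fixed point $z\in C$ (that is, there is exactly one $z\in C$ with $T_1(z)=z$ and $T_2(z)=z$); (ii) for any $u_0\in C$, the sequence $\{u_n\}$ defined by $u_{2k+1}=T_1(u_{2k})$ for all integers $k\geq 0$ and $u_{2k}=T_2(u_{2k-1})$ for all integers $k\geq 1$ converges to $z$, and $$d(u_n,z)\leq \frac{\alpha^{n-1}}{1-\alpha}\,d(u_0,u_1)\quad\text{for all integers } n\geq 1.$$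
   Context: $\mathbb{R}_+=[0,\infty)$. For a fixed real number $\alpha\in[0,1)$, $\Psi_\alpha$ denotes the collection of all mappings $\psi:\mathbb{R}_+^3\to[0,\infty)$ such that: (1) $\psi$ is continuous; and (2) for all $a,b\in\mathbb{R}_+$, if $b\leq\psi(a,a,b)$ or $b\leq\psi(b,a,a)$ or $b\leq\psi(a,b,a)$, then $b\leq\alpha a$. The convention $0^0=1$ is used. *)

theory Defs
  imports "HOL-Analysis.Analysis"
begin

(* A map R_+^3 -> [0,oo) is represented by a total function on real triples; only its
   values at triples of nonnegative reals are constrained. *)
definition Psi :: "real \<Rightarrow> (real \<times> real \<times> real \<Rightarrow> real) set" where
  "Psi \<alpha> = {\<psi>.
     \<psi> \<in> {0..} \<times> {0..} \<times> {0..} \<rightarrow> {0..} \<and>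
     continuous_on ({0..} \<times> {0..} \<times> {0..}) \<psi> \<and>
     (\<forall>a\<ge>0. \<forall>b\<ge>0.
        b \<le> \<psi> (a, a, b) \<or> b \<le> \<psi> (b, a, a) \<or> b \<le> \<psi> (a, b, a) \<longrightarrow> b \<le> \<alpha> * a)}"

end

(* Along an orbit of alternating T\<^sub>1- and T\<^sub>2-steps, two of the three implications defining Psi say
   that consecutive distances shrink by the factor \<alpha>, so the orbit converges with a geometric
   error bound. Passing to the limit in the contraction inequality, the same implications with a = 0
   show that the limit is fixed by both maps, and the remaining one gives uniqueness. *)
theory Submission
  imports Defs
begin

section \<open>Limits and contracting sequences in a metric space\<close>

context Metric_space
begin

text \<open>Continuity of the metric on the carrier, from the quadrilateral inequality |d(x,y) -
  d(l,m)| \<le> d(x,l) + d(y,m), whose right-hand side tends to 0.\<close>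

lemma tendsto_mdist:
  assumes "limitin mtopology f l F" "limitin mtopology g m F"
  shows "((\<lambda>x. d (f x) (g x)) \<longlongrightarrow> d l m) F"
proof -
  have lm: "l \<in> M" "m \<in> M"
    and ev: "\<forall>\<^sub>F x in F. f x \<in> M" "\<forall>\<^sub>F x in F. g x \<in> M"
    and lim: "((\<lambda>x. d (f x) l) \<longlongrightarrow> 0) F" "((\<lambda>x. d (g x) m) \<longlongrightarrow> 0) F"
    using assms by (auto simp: limitin_metric_dist_null)
  have "((\<lambda>x. d (f x) (g x) - d l m) \<longlongrightarrow> 0) F"
  proof (rule Lim_null_comparison)
    show "\<forall>\<^sub>F x in F. norm (d (f x) (g x) - d l m) \<le> d (f x) l + d (g x) m"
      using ev
    proof eventually_elim
      case (elim x)
      have "d (f x) (g x) \<le> d (f x) l + d l (g x)" "d l (g x) \<le> d l m + d m (g x)"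
        "d l m \<le> d l (f x) + d (f x) m" "d (f x) m \<le> d (f x) (g x) + d (g x) m"
        using elim lm by (auto intro: triangle)
      then show ?case
        using commute[of "f x" l] commute[of "g x" m] by simp
    qed
    show "((\<lambda>x. d (f x) l + d (g x) m) \<longlongrightarrow> 0) F"
      using tendsto_add[OF lim] by simp
  qed
  then show ?thesis
    by (simp add: LIM_zero_iff)
qed

text \<open>The n-th step has length at most c^n times the first, and the triangle inequality sums
  the steps from \<open>n\<close> to \<open>n + k\<close> into a geometric series. The bound does
  not depend on \<open>k\<close>, which yields both the Cauchy property and the error
  estimate.\<close>

lemma mdist_contracting_sequence_le:
  fixes c :: real
  assumes "range u \<subseteq> M" and c: "0 \<le> c" "c < 1"
    and step: "\<And>n. d (u (Suc n)) (u (Suc (Suc n))) \<le> c * d (u n) (u (Suc n))"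
  shows "d (u n) (u (n + k)) \<le> c ^ n / (1 - c) * d (u 0) (u 1)"
proof -
  have geom: "d (u n) (u (Suc n)) \<le> c ^ n * d (u 0) (u 1)" for n
  proof (induction n)
    case (Suc n)
    have "d (u (Suc n)) (u (Suc (Suc n))) \<le> c * (c ^ n * d (u 0) (u 1))"
      using step[of n] mult_left_mono[OF Suc c(1)] by linarith
    then show ?case by (simp add: mult.assoc)
  qed simp
  have "d (u n) (u (n + k)) \<le> (\<Sum>i<k. c ^ (n + i) * d (u 0) (u 1))"
  proof (induction k)
    case 0
    have "u n \<in> M" using assms(1) by auto
    then show ?case by simp
  next
    case (Suc k)
    have "d (u n) (u (n + Suc k)) \<le> d (u n) (u (n + k)) + d (u (n + k)) (u (Suc (n + k)))"
      using assms(1) by (auto intro!: triangle)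
    with Suc geom[of "n + k"] show ?case by simp
  qed
  also have "\<dots> = c ^ n * d (u 0) (u 1) * (\<Sum>i<k. c ^ i)"
    unfolding sum_distrib_left by (intro sum.cong) (simp_all add: power_add)
  \<comment> \<open>The partial sum equals (1 - c^k) / (1 - c); the term c^k is dropped.\<close>
  also have "\<dots> \<le> c ^ n * d (u 0) (u 1) * (1 / (1 - c))"
    using c by (intro mult_left_mono) (auto simp: sum_gp_strict divide_right_mono)
  finally show ?thesis by simp
qed

lemma contracting_sequence_MCauchy:
  fixes c :: real
  assumes "range u \<subseteq> M" and c: "0 \<le> c" "c < 1"
    and step: "\<And>n. d (u (Suc n)) (u (Suc (Suc n))) \<le> c * d (u n) (u (Suc n))"
  shows "MCauchy u"
  unfolding MCauchy_def
proof (intro conjI allI impI)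
  fix \<epsilon> :: real assume "\<epsilon> > 0"
  have "(\<lambda>n. c ^ n / (1 - c) * d (u 0) (u 1)) \<longlonglongrightarrow> 0 / (1 - c) * d (u 0) (u 1)"
    using c by (intro tendsto_intros LIMSEQ_power_zero) auto
  then have "\<forall>\<^sub>F n in sequentially. c ^ n / (1 - c) * d (u 0) (u 1) < \<epsilon>"
    using \<open>\<epsilon> > 0\<close> by (simp add: order_tendstoD)
  then obtain N where N: "\<And>n. n \<ge> N \<Longrightarrow> c ^ n / (1 - c) * d (u 0) (u 1) < \<epsilon>"
    by (auto simp: eventually_sequentially)
  have less: "d (u n) (u n') < \<epsilon>" if "N \<le> n" "n \<le> n'" for n n'
    using mdist_contracting_sequence_le[OF assms, of n "n' - n"] N[of n] that by simp
  show "\<exists>N. \<forall>n n'. N \<le> n \<longrightarrow> N \<le> n' \<longrightarrow> d (u n) (u n') < \<epsilon>"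
  proof (intro exI[of _ N] allI impI)
    fix n n' assume "N \<le> n" "N \<le> n'"
    then show "d (u n) (u n') < \<epsilon>"
      using less[of n n'] less[of n' n] commute[of "u n" "u n'"] by (cases "n \<le> n'") auto
  qed
qed (use assms in auto)

text \<open>Let \<open>k\<close> tend to infinity in the bound that is uniform in
  \<open>k\<close>.\<close>

lemma mdist_contracting_sequence_limit_le:
  fixes c :: real
  assumes "range u \<subseteq> M" and c: "0 \<le> c" "c < 1"
    and step: "\<And>n. d (u (Suc n)) (u (Suc (Suc n))) \<le> c * d (u n) (u (Suc n))"
    and lim: "limitin mtopology u z sequentially"
  shows "d (u n) z \<le> c ^ n / (1 - c) * d (u 0) (u 1)"
proof (rule LIMSEQ_le_const2)
  have "u n \<in> M" using assms(1) by auto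
  then show "(\<lambda>k. d (u n) (u (k + n))) \<longlonglongrightarrow> d (u n) z"
    using tendsto_mdist[OF _ limitin_sequentially_offset[OF lim], of "\<lambda>k. u n"] by simp
  show "\<exists>N. \<forall>k\<ge>N. d (u n) (u (k + n)) \<le> c ^ n / (1 - c) * d (u 0) (u 1)"
    using mdist_contracting_sequence_le[OF assms(1-4), of n] by (auto simp: add.commute)
qed

end

section \<open>Using membership in \<open>Psi\<close>\<close>

lemma PsiD:
  assumes "\<psi> \<in> Psi \<alpha>" "a \<ge> 0" "b \<ge> 0"
  shows "b \<le> \<psi> (a, a, b) \<Longrightarrow> b \<le> \<alpha> * a" "b \<le> \<psi> (b, a, a) \<Longrightarrow> b \<le> \<alpha> * a"
    "b \<le> \<psi> (a, b, a) \<Longrightarrow> b \<le> \<alpha> * a"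
  using assms by (auto simp: Psi_def)

text \<open>Continuity of \<open>\<psi>\<close> is available only on the closed octant, so both the
  limit point and the approximating triples must lie there; distances always do.\<close>

lemma tendsto_Psi:
  assumes "\<psi> \<in> Psi \<alpha>" "(f \<longlongrightarrow> a) F" "(g \<longlongrightarrow> b) F" "(h \<longlongrightarrow> c) F"
    and "a \<ge> 0" "b \<ge> 0" "c \<ge> 0"
    and "\<And>x. f x \<ge> 0" "\<And>x. g x \<ge> 0" "\<And>x. h x \<ge> 0"
  shows "((\<lambda>x. \<psi> (f x, g x, h x)) \<longlongrightarrow> \<psi> (a, b, c)) F"
proof -
  let ?O = "{0..} \<times> {0..} \<times> {0..} :: (real \<times> real \<times> real) set"
  have "continuous_on ?O \<psi>"
    using assms(1) by (simp add: Psi_def)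
  moreover have "((\<lambda>x. (f x, g x, h x)) \<longlongrightarrow> (a, b, c)) F"
    using assms(2-4) by (intro tendsto_Pair)
  moreover have "(a, b, c) \<in> ?O" "\<forall>\<^sub>F x in F. (f x, g x, h x) \<in> ?O"
    using assms(5-10) by auto
  ultimately show ?thesis by (rule continuous_on_tendsto_compose)
qed

section \<open>Alternating orbits and common fixed points\<close>

locale Psi_contraction = Metric_space M d
  for M :: "'a set" and d :: "'a \<Rightarrow> 'a \<Rightarrow> real" +
  fixes \<alpha> :: real and \<psi> :: "real \<times> real \<times> real \<Rightarrow> real" and S T :: "'a \<Rightarrow> 'a"
  assumes alpha: "0 \<le> \<alpha>" "\<alpha> < 1"
    and psi: "\<psi> \<in> Psi \<alpha>"
    and maps: "S \<in> M \<rightarrow> M" "T \<in> M \<rightarrow> M"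
    and contr: "\<And>x y. x \<in> M \<Longrightarrow> y \<in> M \<Longrightarrow> d (S x) (T y) \<le> \<psi> (d x y, d x (S x), d y (T y))"
begin

text \<open>\<open>contr\<close> only compares an \<open>S\<close>-image with a
  \<open>T\<close>-image, so the steps alternate. A single successor rule by parity, in place of
  separate even and odd index families, allows induction on n.\<close>

definition orbit :: "(nat \<Rightarrow> 'a) \<Rightarrow> bool" where
  "orbit u \<longleftrightarrow> u 0 \<in> M \<and> (\<forall>n. u (Suc n) = (if even n then S (u n) else T (u n)))"

lemma orbit_exists:
  assumes "x \<in> M"
  shows "\<exists>u. orbit u"
  using assms
  by (intro exI[of _ "rec_nat x (\<lambda>n y. if even n then S y else T y)"]) (simp add: orbit_def)

lemma orbit_in:
  assumes "orbit u"
  shows "u n \<in> M"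
  using assms maps by (induction n) (auto simp: orbit_def)

lemma orbit_step:
  assumes "orbit u"
  shows "d (u (Suc n)) (u (Suc (Suc n))) \<le> \<alpha> * d (u n) (u (Suc n))"
proof -
  let ?a = "d (u n) (u (Suc n))" and ?b = "d (u (Suc n)) (u (Suc (Suc n)))"
  have u: "u (Suc m) = (if even m then S (u m) else T (u m))" for m
    using assms by (simp add: orbit_def)
  show ?thesis
  proof (cases "even n")
    case True
    \<comment> \<open>\<open>S\<close> acts on \<open>u n\<close> and \<open>T\<close> on
      \<open>u (Suc n)\<close>.\<close>
    then have "?b \<le> \<psi> (?a, ?a, ?b)"
      using contr[OF orbit_in orbit_in, OF assms assms, of n "Suc n"] u[of n] u[of "Suc n"] by simp
    then show ?thesis by (intro PsiD(1)[OF psi]) auto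
  next
    case False
    \<comment> \<open>Now \<open>S\<close> acts on the later point, so \<open>contr\<close> is taken
      at (\<open>u (Suc n)\<close>, \<open>u n\<close>), which moves \<open>?b\<close> to the second
      argument.\<close>
    then have "?b \<le> \<psi> (?a, ?b, ?a)"
      using contr[OF orbit_in orbit_in, OF assms assms, of "Suc n" n] u[of n] u[of "Suc n"]
      by (simp add: commute)
    then show ?thesis by (intro PsiD(3)[OF psi]) auto
  qed
qed

lemma orbit_limit_fixed:
  assumes "orbit u" and lim: "limitin mtopology u z sequentially"
  shows "S z = z \<and> T z = z"
proof -
  have z: "z \<in> M" using lim by (rule limitin_mspace)
  then have Sz: "S z \<in> M" and Tz: "T z \<in> M" using maps by auto
  have uM: "u n \<in> M" for n using assms(1) by (rule orbit_in)
  have even_step: "S (u (2 * k)) = u (2 * k + 1)" for k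
    using assms(1) by (simp add: orbit_def)
  have odd_step: "T (u (2 * k + 1)) = u (2 * k + 2)" for k
    using assms(1) by (simp add: orbit_def)
  \<comment> \<open>Splitting by parity fixes which map acts; the offsets 0, 1 and 2 are the ones
    used.\<close>
  have lims: "limitin mtopology (\<lambda>k. u (2 * k + j)) z sequentially" for j
    using limitin_subsequence[OF _ lim, of "\<lambda>k. 2 * k + j"]
    by (simp add: o_def strict_mono_def)
  have const: "limitin mtopology (\<lambda>k. y) y sequentially" if "y \<in> M" for y
    using that by simp
  note lim0 = lims[of 0, simplified]
  have zz: "d z z = 0" using z by simp
  \<comment> \<open>Limit of \<open>contr\<close> at (\<open>u (2 * k)\<close>, \<open>z\<close>):
    the first two arguments tend to d(z,z) = 0.\<close>
  have "d z (T z) \<le> \<psi> (0, 0, d z (T z))"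
  proof (rule LIMSEQ_le)
    show "(\<lambda>k. d (u (2 * k + 1)) (T z)) \<longlonglongrightarrow> d z (T z)"
      by (intro tendsto_mdist lims const Tz)
    show "(\<lambda>k. \<psi> (d (u (2 * k)) z, d (u (2 * k)) (u (2 * k + 1)), d z (T z)))
        \<longlonglongrightarrow> \<psi> (0, 0, d z (T z))"
      using tendsto_mdist[OF lim0 const[OF z]] tendsto_mdist[OF lim0 lims[of 1]]
      by (intro tendsto_Psi[OF psi]) (auto simp: zz)
    show "\<exists>N. \<forall>k\<ge>N. d (u (2 * k + 1)) (T z)
        \<le> \<psi> (d (u (2 * k)) z, d (u (2 * k)) (u (2 * k + 1)), d z (T z))"
      using contr[OF uM z, of "2 * _"] by (simp only: even_step) blast
  qed
  then have "d z (T z) \<le> \<alpha> * 0" by (intro PsiD(1)[OF psi]) auto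
  then have "T z = z" using z Tz nonneg[of z "T z"] zero[of z "T z"] by force
  \<comment> \<open>Limit of \<open>contr\<close> at (\<open>z\<close>,
    \<open>u (2 * k + 1)\<close>): here the outer two arguments vanish.\<close>
  have "d (S z) z \<le> \<psi> (0, d z (S z), 0)"
  proof (rule LIMSEQ_le)
    show "(\<lambda>k. d (S z) (u (2 * k + 2))) \<longlonglongrightarrow> d (S z) z"
      by (intro tendsto_mdist lims const Sz)
    show "(\<lambda>k. \<psi> (d z (u (2 * k + 1)), d z (S z), d (u (2 * k + 1)) (u (2 * k + 2))))
        \<longlonglongrightarrow> \<psi> (0, d z (S z), 0)"
      using tendsto_mdist[OF const[OF z] lims[of 1]] tendsto_mdist[OF lims[of 1] lims[of 2]]
      by (intro tendsto_Psi[OF psi]) (auto simp: zz)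
    show "\<exists>N. \<forall>k\<ge>N. d (S z) (u (2 * k + 2))
        \<le> \<psi> (d z (u (2 * k + 1)), d z (S z), d (u (2 * k + 1)) (u (2 * k + 2)))"
      using contr[OF z uM, of "2 * _ + 1"] by (simp only: odd_step) blast
  qed
  then have "d z (S z) \<le> \<alpha> * 0"
    by (intro PsiD(3)[OF psi]) (auto simp: commute)
  then have "S z = z" using z Sz nonneg[of z "S z"] zero[of z "S z"] by force
  with \<open>T z = z\<close> show ?thesis by simp
qed

text \<open>In \<open>contr\<close> at (\<open>z\<close>, \<open>w\<close>) both displacements are
  0, so only the first argument survives and the second implication of \<open>Psi\<close> applies
  with a = 0.\<close>

lemma common_fixed_point_unique:
  assumes "z \<in> M" "S z = z" "w \<in> M" "T z = z" "S w = w" "T w = w"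
  shows "z = w"
proof -
  have "d z w \<le> \<psi> (d z w, 0, 0)"
    using contr[of z w] assms by simp
  then have "d z w \<le> \<alpha> * 0" by (intro PsiD(2)[OF psi]) auto
  then show ?thesis using nonneg[of z w] zero[of z w] assms by force
qed

lemma orbit_convergent:
  assumes "mcomplete" "orbit u"
  shows "\<exists>z. limitin mtopology u z sequentially"
proof -
  have "range u \<subseteq> M" using orbit_in[OF assms(2)] by auto
  then have "MCauchy u"
    using alpha orbit_step[OF assms(2)] by (rule contracting_sequence_MCauchy)
  then show ?thesis using assms(1) by (simp add: mcomplete_def)
qed

end

theorem theorem2p1:
  fixes C :: "'a set"
    and d :: "'a \<Rightarrow> 'a \<Rightarrow> real"
    and \<alpha> :: real
    and \<psi> :: "real \<times> real \<times> real \<Rightarrow> real"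
    and T\<^sub>1 T\<^sub>2 :: "'a \<Rightarrow> 'a"
  assumes "Metric_space C d"
    and "Metric_space.mcomplete C d"
    and "C \<noteq> {}"
    and "0 \<le> \<alpha>" and "\<alpha> < 1"
    and "\<psi> \<in> Psi \<alpha>"
    and "T\<^sub>1 \<in> C \<rightarrow> C" and "T\<^sub>2 \<in> C \<rightarrow> C"
    and "\<And>x y. x \<in> C \<Longrightarrow> y \<in> C \<Longrightarrow>
           d (T\<^sub>1 x) (T\<^sub>2 y) \<le> \<psi> (d x y, d x (T\<^sub>1 x), d y (T\<^sub>2 y))"
  shows "(\<exists>!z. z \<in> C \<and> T\<^sub>1 z = z \<and> T\<^sub>2 z = z) \<and>
    (\<forall>z. z \<in> C \<and> T\<^sub>1 z = z \<and> T\<^sub>2 z = z \<longrightarrow>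
      (\<forall>u :: nat \<Rightarrow> 'a.
        u 0 \<in> C \<and>
        (\<forall>k. u (2 * k + 1) = T\<^sub>1 (u (2 * k))) \<and>
        (\<forall>k\<ge>1. u (2 * k) = T\<^sub>2 (u (2 * k - 1))) \<longrightarrow>
          limitin (Metric_space.mtopology C d) u z sequentially \<and>
          (\<forall>n\<ge>1. d (u n) z \<le> \<alpha> ^ (n - 1) / (1 - \<alpha>) * d (u 0) (u 1))))"
proof -
  interpret Psi_contraction C d \<alpha> \<psi> T\<^sub>1 T\<^sub>2
    using assms by (intro Psi_contraction.intro Psi_contraction_axioms.intro) auto
  \<comment> \<open>The limit may a priori vary with the orbit; uniqueness later identifies it with
    the given \<open>z\<close>.\<close>
  have limit: "\<exists>z\<in>C. T\<^sub>1 z = z \<and> T\<^sub>2 z = z \<and> limitin mtopology u z sequentially" if "orbit u" for u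
    using orbit_convergent[OF assms(2) that] orbit_limit_fixed[OF that] limitin_mspace by blast
  obtain x where "x \<in> C" using assms(3) by auto
  then obtain z where "z \<in> C" "T\<^sub>1 z = z" "T\<^sub>2 z = z"
    using orbit_exists limit by blast
  then have unique: "\<exists>!z. z \<in> C \<and> T\<^sub>1 z = z \<and> T\<^sub>2 z = z"
    using common_fixed_point_unique by blast
  have "limitin mtopology u z sequentially \<and>
      (\<forall>n\<ge>1. d (u n) z \<le> \<alpha> ^ (n - 1) / (1 - \<alpha>) * d (u 0) (u 1))"
    if z: "z \<in> C \<and> T\<^sub>1 z = z \<and> T\<^sub>2 z = z"
      and u: "u 0 \<in> C" "\<And>k. u (2 * k + 1) = T\<^sub>1 (u (2 * k))"
        "\<And>k. k \<ge> 1 \<Longrightarrow> u (2 * k) = T\<^sub>2 (u (2 * k - 1))" for z and u :: "nat \<Rightarrow> 'a"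
  proof -
    have "u (Suc n) = (if even n then T\<^sub>1 (u n) else T\<^sub>2 (u n))" for n
    proof (cases "even n")
      case True
      then show ?thesis using u(2)[of "n div 2"] by simp
    next
      case False
      \<comment> \<open>For odd \<open>n\<close> this index is at least 1, as \<open>u(3)\<close>
        demands.\<close>
      then show ?thesis using u(3)[of "Suc n div 2"] by simp
    qed
    then have orb: "orbit u" using u(1) by (simp add: orbit_def)
    then have lim: "limitin mtopology u z sequentially"
      using limit unique z by blast
    \<comment> \<open>The orbit satisfies the sharper bound with exponent \<open>n\<close>, which is
      weakened using 0 \<le> \<alpha> < 1. At \<open>n = 0\<close> truncated subtraction makes both
      exponents 0.\<close>
    have "d (u n) z \<le> \<alpha> ^ (n - 1) / (1 - \<alpha>) * d (u 0) (u 1)" for n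
    proof -
      have "range u \<subseteq> C" using orbit_in[OF orb] by auto
      then have "d (u n) z \<le> \<alpha> ^ n / (1 - \<alpha>) * d (u 0) (u 1)"
        using alpha orbit_step[OF orb] lim by (rule mdist_contracting_sequence_limit_le)
      also have "\<dots> \<le> \<alpha> ^ (n - 1) / (1 - \<alpha>) * d (u 0) (u 1)"
        using alpha by (intro mult_right_mono divide_right_mono power_decreasing) auto
      finally show ?thesis .
    qed
    with lim show ?thesis by blast
  qed
  with unique show ?thesis by blast
qed

end
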